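(* Let $p\in\Omega$, let $I_d(p)$ be its discrete Fisher information and $N_d(p)$ its entropy power. Then $$N_d(p)\,I_d(p) > 1.$$ Moreover, if there exists an optimal constant $\beta$ for this inequality, i.e. a smallest real number $\beta$ such that $\beta N_d(p) I_d(p) > 1$ holds for all $p\in\Omega$, then $e^{-2}\leq \beta\leq 1$.
   Context: $\mathbb{N}_0=\{0,1,2,\dots\}$. $\Omega$ is the set of probability mass functions $p$ on $\mathbb{N}_0$ (so $p(i)\ge 0$ and $\sum_{i=0}^\infty p(i)=1$) which satisfy $\lim_{i\to\infty}p(i)=0$; a pmf with finite support in $\{0,\dots,N-1\}$ is extended by $p(i)=0$ for all $i\ge N$. The discrete Fisher information of $p\in\Omega$ is $$I_d(p)=4\sum_{i=0}^\infty\bigl(\sqrt{p(i+1)}-\sqrt{p(i)}\bigr)^2.$$ The Shannon entropy is $H(p)=-\sum_{i=0}^\infty p(i)\log p(i)$ (natural logarithm, $0\log 0=0$), and the entropy power is $N_d(p)=\exp(2H(p))$. If $H(p)=+\infty$ then $N_d(p)=+\infty$, and a product of $+\infty$ with a positive real number is $+\infty$. *)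

theory Defs
  imports "HOL-Probability.Probability"
begin

(* The limit condition holds for every pmf on nat; it is kept because the class is specified by it. *)
definition Omega :: "nat pmf set" where
  "Omega = {p. pmf p \<longlonglongrightarrow> 0}"

definition fisher_info :: "nat pmf \<Rightarrow> real" where
  "fisher_info p = 4 * (\<Sum>i. (sqrt (pmf p (i + 1)) - sqrt (pmf p i))\<^sup>2)"

lemma summable_pmf_nat: "summable (pmf (p :: nat pmf))"
proof (rule bounded_imp_summable)
  show "0 \<le> pmf p i" for i
    by simp
  show "(\<Sum>i\<le>n. pmf p i) \<le> 1" for n
    using measure_pmf.prob_le_1[of p "{..n}"] by (simp add: measure_measure_pmf_finite)
qed

(* The series in fisher_info always converges, so the real-valued suminf is never a default value. *)
lemma summable_fisher_info:
  "summable (\<lambda>i. (sqrt (pmf p (i + 1)) - sqrt (pmf p i))\<^sup>2)"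
proof (rule summable_comparison_test')
  show "summable (\<lambda>i. pmf p (i + 1) + pmf p i)"
    using summable_pmf_nat[of p] by (intro summable_add) (simp_all add: summable_Suc_iff)
  show "norm ((sqrt (pmf p (i + 1)) - sqrt (pmf p i))\<^sup>2) \<le> pmf p (i + 1) + pmf p i"
    if "i \<ge> 0" for i
  proof -
    have "norm ((sqrt (pmf p (i + 1)) - sqrt (pmf p i))\<^sup>2)
        = (sqrt (pmf p (i + 1)) - sqrt (pmf p i))\<^sup>2"
      by simp
    also have "\<dots> = pmf p (i + 1) + pmf p i - 2 * (sqrt (pmf p (i + 1)) * sqrt (pmf p i))"
      by (simp add: power2_diff)
    also have "\<dots> \<le> pmf p (i + 1) + pmf p i"
      by simp
    finally show ?thesis .
  qed
qed

(* Each summand lies in [0, \<infinity>) since 0 \<le> pmf p i \<le> 1, and it vanishes where pmf p i = 0;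
   the sum is taken in the extended reals, so a divergent series has the value \<infinity>. *)
definition shannon_entropy :: "nat pmf \<Rightarrow> ereal" where
  "shannon_entropy p = (\<Sum>i. ereal (- (pmf p i * ln (pmf p i))))"

(* The value -\<infinity> does not occur as an entropy. *)
definition entropy_power :: "nat pmf \<Rightarrow> ereal" where
  "entropy_power p =
     (if shannon_entropy p = \<infinity> then \<infinity> else ereal (exp (2 * real_of_ereal (shannon_entropy p))))"

lemma shannon_entropy_nonneg: "0 \<le> shannon_entropy p"
  unfolding shannon_entropy_def
proof (rule suminf_nonneg)
  have nn: "0 \<le> ereal (- (pmf p i * ln (pmf p i)))" for i
  proof -
    have "ln (pmf p i) \<le> 0"
      using pmf_nonneg[of p i] pmf_le_1[of p i] by (cases "pmf p i = 0") simp_all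
    then show ?thesis
      by (simp add: mult_nonneg_nonpos)
  qed
  then show "summable (\<lambda>i. ereal (- (pmf p i * ln (pmf p i))))"
    by (rule summable_ereal_pos)
  show "0 \<le> ereal (- (pmf p i * ln (pmf p i)))" for i
    by (rule nn)
qed

definition admissible_consts :: "real set" where
  "admissible_consts =
     {\<beta>. \<forall>p\<in>Omega. ereal \<beta> * entropy_power p * ereal (fisher_info p) > 1}"

definition optimal_const :: "real \<Rightarrow> bool" where
  "optimal_const \<beta> \<longleftrightarrow> \<beta> \<in> admissible_consts \<and> (\<forall>\<gamma>\<in>admissible_consts. \<beta> \<le> \<gamma>)"

end

theory Submission
  imports Defs "HOL-Real_Asymp.Real_Asymp"
begin

text \<open>
  The inequality compares both factors with the largest mass \<open>M\<close> of the distribution.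

  On the one hand every surprisal \<open>- ln (p i)\<close> is at least \<open>- ln M\<close>, so the entropy, being
  their average, is at least \<open>- ln M\<close>, and the entropy power is at least \<open>1 / M\<^sup>2\<close>
  (\<open>shannon_entropy_ge_mode\<close>).  On the other hand a distribution with a high peak must have a
  large Fisher information: starting at the peak \<open>m\<close>, the mass has to descend from \<open>M\<close> to \<open>0\<close>, and
  each step factors as
  \<open>p i - p (i + 1) = (sqrt (p i) - sqrt (p (i + 1))) * (sqrt (p i) + sqrt (p (i + 1)))\<close>.
  By Cauchy-Schwarz, \<open>M\<^sup>2\<close> is at most the product of the two sums of squares.  The first is at most a
  quarter of the Fisher information.  The second is at most \<open>4 - 2 * M\<close>, because
  \<open>(x + y)\<^sup>2 \<le> 2 * (x\<^sup>2 + y\<^sup>2)\<close> and the shifted sum misses the mass at the peak.  The missing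
  mass is what makes the final inequality strict (\<open>pmf_square_less_fisher_info\<close>).

  In particular \<open>1\<close> is an admissible constant, which bounds an optimal one from above.  For the lower
  bound, both functionals have closed forms on the geometric distributions, and their product
  tends to \<open>exp 2\<close> as the success probability tends to \<open>0\<close> (\<open>geometric_product_tendsto\<close>).
\<close>

section \<open>A high peak forces a large Fisher information\<close>

lemma sum_pmf_le_1: "finite A \<Longrightarrow> sum (pmf p) A \<le> 1"
  using measure_pmf.prob_le_1[of p A] by (simp add: measure_measure_pmf_finite)

lemma fisher_info_nonneg: "0 \<le> fisher_info p"
  unfolding fisher_info_def using summable_fisher_info[of p] by (auto intro!: suminf_nonneg)

text \<open>
  This is the Cauchy-Schwarz step, applied on a finite stretch to the right of \<open>m\<close>, where the
  differences telescope.
\<close>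

lemma pmf_descent_square_le:
  fixes p :: "nat pmf"
  shows "(pmf p m - pmf p (m + n))\<^sup>2 \<le> fisher_info p * (1 - pmf p m / 2)"
proof -
  define d where "d i = sqrt (pmf p (i + 1)) - sqrt (pmf p i)" for i
  define s where "s i = sqrt (pmf p (i + 1)) + sqrt (pmf p i)" for i
  have prod: "d i * s i = pmf p (Suc i) - pmf p i" for i
    by (simp add: d_def s_def algebra_simps)
  have tele: "(\<Sum>i=m..<m+n. d i * s i) = pmf p (m + n) - pmf p m"
    unfolding prod by (rule sum_Suc_diff') simp
  have dsum: "(\<Sum>i=m..<m+n. (d i)\<^sup>2) \<le> fisher_info p / 4"
    unfolding d_def fisher_info_def
    using sum_le_suminf[OF summable_fisher_info[of p], of "{m..<m+n}"] by simp
  have ssq: "(s i)\<^sup>2 \<le> 2 * pmf p i + 2 * pmf p (Suc i)" for i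
  proof -
    have "0 \<le> (d i)\<^sup>2" by simp
    then show ?thesis by (simp add: d_def s_def power2_diff power2_sum)
  qed
  have shifted: "(\<Sum>i=m..<m+n. pmf p (Suc i)) \<le> 1 - pmf p m"
  proof -
    have "(\<Sum>i=m..<m+n. pmf p (Suc i)) + pmf p m = sum (pmf p) {m..<Suc (m+n)}"
      by (simp add: sum.shift_bounds_Suc_ivl[symmetric] sum.atLeast_Suc_lessThan[of m "Suc (m+n)"]
          del: sum.op_ivl_Suc)
    then show ?thesis using sum_pmf_le_1[of "{m..<Suc (m+n)}" p] by simp
  qed
  have "(\<Sum>i=m..<m+n. (s i)\<^sup>2) \<le> (\<Sum>i=m..<m+n. 2 * pmf p i + 2 * pmf p (Suc i))"
    by (intro sum_mono ssq)
  also have "\<dots> = 2 * sum (pmf p) {m..<m+n} + 2 * (\<Sum>i=m..<m+n. pmf p (Suc i))"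
    by (simp add: sum.distrib sum_distrib_left)
  also have "\<dots> \<le> 4 - 2 * pmf p m"
    using shifted sum_pmf_le_1[of "{m..<m+n}" p] by simp
  finally have ssum: "(\<Sum>i=m..<m+n. (s i)\<^sup>2) \<le> 4 - 2 * pmf p m" .
  have "(pmf p m - pmf p (m + n))\<^sup>2 = (\<Sum>i=m..<m+n. d i * s i)\<^sup>2"
    unfolding tele by (rule power2_commute)
  also have "\<dots> \<le> (\<Sum>i=m..<m+n. (d i)\<^sup>2) * (\<Sum>i=m..<m+n. (s i)\<^sup>2)"
    by (rule Cauchy_Schwarz_ineq_sum)
  also have "\<dots> \<le> (fisher_info p / 4) * (4 - 2 * pmf p m)"
    using fisher_info_nonneg[of p] by (intro mult_mono dsum ssum) (auto intro: sum_nonneg)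
  finally show ?thesis by (simp add: field_simps)
qed

text \<open>
  Letting the stretch grow, the mass at its right end vanishes.  The factor \<open>1 - pmf p m / 2\<close>
  then gives strictness.
\<close>

lemma pmf_square_less_fisher_info:
  fixes p :: "nat pmf"
  assumes lim: "pmf p \<longlonglongrightarrow> 0" and pos: "0 < pmf p m"
  shows "(pmf p m)\<^sup>2 < fisher_info p"
proof -
  have "(\<lambda>n. pmf p (m + n)) \<longlonglongrightarrow> 0"
    using LIMSEQ_ignore_initial_segment[OF lim, of m] by (simp add: add.commute)
  then have "(\<lambda>n. (pmf p m - pmf p (m + n))\<^sup>2) \<longlonglongrightarrow> (pmf p m - 0)\<^sup>2"
    by (intro tendsto_intros)
  then have le: "(pmf p m)\<^sup>2 \<le> fisher_info p * (1 - pmf p m / 2)"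
    using LIMSEQ_le_const2[where a = "fisher_info p * (1 - pmf p m / 2)"]
      pmf_descent_square_le by fastforce
  have "fisher_info p \<noteq> 0" using le pos by auto
  then have "0 < fisher_info p * pmf p m"
    using fisher_info_nonneg[of p] pos by simp
  then show ?thesis using le by (simp add: algebra_simps)
qed

section \<open>The entropy is bounded below by the surprisal of the mode\<close>

text \<open>
  Only finitely many points carry more mass than a given point of the support, so the supremum of
  the masses is attained.
\<close>

lemma pmf_nat_mode_exists:
  fixes p :: "nat pmf"
  assumes lim: "pmf p \<longlonglongrightarrow> 0"
  obtains m where "0 < pmf p m" "\<And>i. pmf p i \<le> pmf p m"
proof -
  obtain k where k: "0 < pmf p k"
    using set_pmf_not_empty[of p] by (auto simp: set_pmf_iff pmf_positive_iff)
  from order_tendstoD(2)[OF lim k] obtain N where N: "\<And>i. i \<ge> N \<Longrightarrow> pmf p i < pmf p k"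
    by (auto simp: eventually_sequentially)
  have "Max (pmf p ` {..N + k}) \<in> pmf p ` {..N + k}"
    by (intro Max_in) auto
  then obtain m where "Max (pmf p ` {..N + k}) = pmf p m" by blast
  then have m: "pmf p i \<le> pmf p m" if "i \<le> N + k" for i
    using that Max_ge[of "pmf p ` {..N + k}" "pmf p i"] by simp
  show thesis
  proof
    show "0 < pmf p m" using k m[of k] by simp
    show "pmf p i \<le> pmf p m" for i
      using m[of i] m[of k] N[of i] by (cases "i \<le> N + k") auto
  qed
qed

text \<open>
  The entropy is the mean of the surprisals \<open>- ln (pmf p i)\<close>, and the mode has the smallest one.
  Since that one is nonnegative, the termwise comparison is one of series with nonnegative terms,
  and it includes the case of infinite entropy.
\<close>

lemma shannon_entropy_ge_mode:
  fixes p :: "nat pmf"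
  assumes max: "\<And>i. pmf p i \<le> pmf p m"
  shows "ereal (- ln (pmf p m)) \<le> shannon_entropy p"
proof -
  define c where "c = - ln (pmf p m)"
  have c: "0 \<le> c"
    using pmf_le_1[of p m] pmf_nonneg[of p m] unfolding c_def by (cases "pmf p m = 0") simp_all
  have "pmf p sums 1"
    using sums_infsetsum_nat'[of "pmf p"] infsetsum_pmf_eq_1[of p UNIV] pmf_abs_summable[of p UNIV]
    by simp
  then have "(\<lambda>i. pmf p i * c) sums (1 * c)"
    by (rule sums_mult2)
  then have "(\<lambda>i. ereal (pmf p i * c)) sums ereal c"
    by (simp add: sums_ereal)
  then have "ereal c = (\<Sum>i. ereal (pmf p i * c))"
    by (rule sums_unique)
  also have "\<dots> \<le> shannon_entropy p"
    unfolding shannon_entropy_def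
  proof (rule suminf_le_pos)
    show "0 \<le> ereal (pmf p i * c)" for i using c by simp
    show "ereal (pmf p i * c) \<le> ereal (- (pmf p i * ln (pmf p i)))" for i
    proof (cases "pmf p i = 0")
      case False
      then have "0 < pmf p i" using pmf_nonneg[of p i] by linarith
      then have "ln (pmf p i) \<le> ln (pmf p m)" using max[of i] by simp
      then have "c \<le> - ln (pmf p i)" by (simp add: c_def)
      then have "pmf p i * c \<le> pmf p i * - ln (pmf p i)" by (intro mult_left_mono) auto
      then show ?thesis by simp
    qed simp
  qed
  finally show ?thesis by (simp add: c_def)
qed

lemma fisher_info_entropy_power_gt_1:
  assumes "p \<in> Omega"
  shows "1 < entropy_power p * ereal (fisher_info p)"
proof -
  have lim: "pmf p \<longlonglongrightarrow> 0" using assms by (simp add: Omega_def)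
  obtain m where pos: "0 < pmf p m" and max: "\<And>i. pmf p i \<le> pmf p m"
    using pmf_nat_mode_exists[OF lim] by blast
  have I: "(pmf p m)\<^sup>2 < fisher_info p"
    by (rule pmf_square_less_fisher_info[OF lim pos])
  have Ipos: "0 < fisher_info p" using I by (smt (verit) zero_le_power2)
  show ?thesis
  proof (cases "shannon_entropy p")
    case (real h)
    have "- ln (pmf p m) \<le> h"
      using shannon_entropy_ge_mode[OF max] real by simp
    then have "1 / pmf p m \<le> exp h"
      using pos by (metis exp_le_cancel_iff exp_ln exp_minus inverse_eq_divide)
    then have "(1 / pmf p m)\<^sup>2 \<le> (exp h)\<^sup>2"
      using pos by (intro power_mono) auto
    then have N: "1 / (pmf p m)\<^sup>2 \<le> exp (2 * h)"
      by (simp add: power_one_over exp_double)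
    have "1 < 1 / (pmf p m)\<^sup>2 * fisher_info p" using I pos by simp
    also have "\<dots> \<le> exp (2 * h) * fisher_info p"
      using N Ipos by (intro mult_right_mono) auto
    finally show ?thesis using real by (simp add: entropy_power_def)
  next
    case PInf
    then show ?thesis using Ipos by (simp add: entropy_power_def)
  next
    case MInf
    then show ?thesis using shannon_entropy_nonneg[of p] by simp
  qed
qed

section \<open>Geometric distributions with small success probability\<close>

text \<open>
  The scaling limit of the geometric distributions as \<open>s\<close> tends to \<open>0\<close> is the exponential
  distribution.  With rate \<open>r\<close> it has differential entropy \<open>1 - ln r\<close> and Fisher information
  \<open>r\<^sup>2\<close>, so that the product of entropy power and Fisher information is \<open>exp 2\<close>.
\<close>

lemma fisher_info_geometric:
  fixes s :: real
  assumes s: "0 < s" "s < 1"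
  shows "fisher_info (geometric_pmf s) = 4 * (1 - sqrt (1 - s))\<^sup>2"
proof -
  define q where "q = 1 - s"
  have q: "0 < q" "q < 1" using s by (auto simp: q_def)
  have "(sqrt (pmf (geometric_pmf s) (i + 1)) - sqrt (pmf (geometric_pmf s) i))\<^sup>2
      = (s * (1 - sqrt q)\<^sup>2) * q ^ i" for i
  proof -
    have "sqrt (pmf (geometric_pmf s) (i + 1)) - sqrt (pmf (geometric_pmf s) i)
        = - (sqrt (q ^ i) * sqrt s * (1 - sqrt q))"
      using s by (simp add: q_def[symmetric] real_sqrt_mult right_diff_distrib)
    then show ?thesis using s q by (simp add: power_mult_distrib)
  qed
  then have "fisher_info (geometric_pmf s) = 4 * (\<Sum>i. (s * (1 - sqrt q)\<^sup>2) * q ^ i)"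
    unfolding fisher_info_def by simp
  also have "(\<Sum>i. (s * (1 - sqrt q)\<^sup>2) * q ^ i) = (s * (1 - sqrt q)\<^sup>2) * (1 / (1 - q))"
    using q by (subst suminf_mult) (auto simp: suminf_geometric)
  also have "\<dots> = (1 - sqrt q)\<^sup>2" using s by (simp add: q_def)
  finally show ?thesis by (simp add: q_def)
qed

text \<open>
  The surprisal of the value \<open>i\<close> is \<open>- ln s - i * ln (1 - s)\<close>, affine in \<open>i\<close>, so the entropy
  only depends on the mean \<open>(1 - s) / s\<close>.
\<close>

lemma shannon_entropy_geometric:
  fixes s :: real
  assumes s: "0 < s" "s < 1"
  shows "shannon_entropy (geometric_pmf s) = ereal (- ln s - (1 - s) * ln (1 - s) / s)"
proof -
  define q where "q = 1 - s"
  have q: "0 < q" "q < 1" using s by (auto simp: q_def)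
  have geo: "(\<lambda>i. q ^ i) sums (1 / s)"
    using geometric_sums[of q] q by (simp add: q_def)
  have "(\<lambda>i. of_nat (Suc i) * q ^ i) sums (1 / s\<^sup>2)"
    using geometric_deriv_sums[of q] q by (simp add: q_def)
  from sums_diff[OF this geo] have mean: "(\<lambda>i. real i * q ^ i) sums (1 / s\<^sup>2 - 1 / s)"
    by (simp add: algebra_simps)
  have "(\<lambda>i. (- s * ln s) * q ^ i + (- s * ln q) * (real i * q ^ i)) sums
      ((- s * ln s) * (1 / s) + (- s * ln q) * (1 / s\<^sup>2 - 1 / s))"
    by (intro sums_add sums_mult geo mean)
  moreover have "(- s * ln s) * q ^ i + (- s * ln q) * (real i * q ^ i)
      = - (pmf (geometric_pmf s) i * ln (pmf (geometric_pmf s) i))" for i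
    using s q by (simp add: q_def[symmetric] ln_mult ln_realpow algebra_simps)
  moreover have "(- s * ln s) * (1 / s) + (- s * ln q) * (1 / s\<^sup>2 - 1 / s)
      = - ln s - (1 - s) * ln (1 - s) / s"
    using s by (simp add: q_def field_simps power2_eq_square)
  ultimately have "(\<lambda>i. - (pmf (geometric_pmf s) i * ln (pmf (geometric_pmf s) i))) sums
      (- ln s - (1 - s) * ln (1 - s) / s)"
    by simp
  then show ?thesis
    unfolding shannon_entropy_def
    by (intro sums_unique[symmetric]) (simp add: sums_ereal)
qed

lemma geometric_product_tendsto:
  "((\<lambda>s::real. exp (2 * (- ln s - (1 - s) * ln (1 - s) / s)) * (4 * (1 - sqrt (1 - s))\<^sup>2))
     \<longlongrightarrow> exp 2) (at_right 0)"
  by (real_asymp simp: power2_eq_square)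

text \<open>
  An admissible constant works for every geometric distribution, and hence, weakly, in the limit.
\<close>

lemma admissible_const_ge:
  assumes "\<beta> \<in> admissible_consts"
  shows "exp (-2) \<le> \<beta>"
proof -
  define f :: "real \<Rightarrow> real" where
    "f s = exp (2 * (- ln s - (1 - s) * ln (1 - s) / s)) * (4 * (1 - sqrt (1 - s))\<^sup>2)" for s
  have "1 < \<beta> * f s" if s: "0 < s" "s < 1" for s
  proof -
    have "geometric_pmf s \<in> Omega"
      unfolding Omega_def using summable_LIMSEQ_zero[OF summable_pmf_nat] by simp
    then have "1 < ereal \<beta> * entropy_power (geometric_pmf s) * ereal (fisher_info (geometric_pmf s))"
      using assms by (auto simp: admissible_consts_def)
    then show ?thesis
      by (simp add: entropy_power_def shannon_entropy_geometric[OF s]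
          fisher_info_geometric[OF s] f_def mult.assoc)
  qed
  then have "eventually (\<lambda>s. 1 \<le> \<beta> * f s) (at_right 0)"
    unfolding eventually_at_right_field by (intro exI[of _ 1]) (auto intro: less_imp_le)
  moreover have "((\<lambda>s. \<beta> * f s) \<longlongrightarrow> \<beta> * exp 2) (at_right 0)"
    unfolding f_def by (intro tendsto_mult_left geometric_product_tendsto)
  ultimately have "1 \<le> \<beta> * exp 2"
    by (intro tendsto_lowerbound[of _ _ "at_right (0::real)"]) auto
  then show ?thesis by (simp add: exp_minus field_simps)
qed

theorem proposition1:
  shows "(\<forall>p\<in>Omega. entropy_power p * ereal (fisher_info p) > 1) \<and>
         (\<forall>\<beta>. optimal_const \<beta> \<longrightarrow> exp (-2) \<le> \<beta> \<and> \<beta> \<le> 1)"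
proof (intro conjI ballI allI impI)
  show "1 < entropy_power p * ereal (fisher_info p)" if "p \<in> Omega" for p
    using that by (rule fisher_info_entropy_power_gt_1)
  fix \<beta> assume opt: "optimal_const \<beta>"
  then show "exp (-2) \<le> \<beta>"
    by (intro admissible_const_ge) (simp add: optimal_const_def)
  have "1 \<in> admissible_consts"
    using fisher_info_entropy_power_gt_1 by (simp add: admissible_consts_def)
  then show "\<beta> \<le> 1" using opt by (simp add: optimal_const_def)
qed

end
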